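(* For every positive integer $N$, \[ \sum_{\substack{\pi\in\mathcal{O}\\ |\pi|=N}} (-1)^{s(\pi)+\nu_e(\pi)+1} \;=\; r_2(N) - 2\chi(N \text{ is a perfect square}). \]
   Context: An overpartition is a finite non-increasing sequence of positive integers (its parts) in which the last occurrence of each distinct part size may or may not be marked (overlined). $\mathcal{O}$ is the set of all non-empty overpartitions. For $\pi\in\mathcal{O}$: $|\pi|$ is the sum of its parts, $s(\pi)$ its smallest part, and $\nu_e(\pi)$ the number of even parts counted with multiplicity. $r_2(N)$ is the number of pairs $(x,y)\in\mathbb{Z}^2$ with $x^2+y^2=N$. $\chi(S)$ is $1$ if the statement $S$ is true and $0$ otherwise. *)

theory Defs
  imports Complex_Main "HOL-Computational_Algebra.Nth_Powers"
begin

text \<open>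
  An overpartition is a list of pairs (part, mark), in the order in which the parts are written;
  the mark is \<^term>\<open>True\<close> iff that occurrence of the part is overlined.
  Only the last occurrence of each part size may be overlined.
\<close>

type_synonym marked_parts = "(nat \<times> bool) list"

definition overpartition :: "marked_parts \<Rightarrow> bool" where
  "overpartition p \<longleftrightarrow>
     sorted_wrt (\<ge>) (map fst p) \<and>
     (\<forall>i<length p. fst (p ! i) > 0) \<and>
     (\<forall>i<length p. snd (p ! i) \<longrightarrow> (\<forall>j. i < j \<and> j < length p \<longrightarrow> fst (p ! j) \<noteq> fst (p ! i)))"

definition overpartitions :: "marked_parts set" where
  "overpartitions = {p. overpartition p \<and> p \<noteq> []}"

definition weight :: "marked_parts \<Rightarrow> nat" where
  "weight p = sum_list (map fst p)"

definition smallest_part :: "marked_parts \<Rightarrow> nat" where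
  "smallest_part p = Min (fst ` set p)"

definition num_even_parts :: "marked_parts \<Rightarrow> nat" where
  "num_even_parts p = length (filter even (map fst p))"

definition r2 :: "nat \<Rightarrow> nat" where
  "r2 N = card {(x :: int, y :: int). x\<^sup>2 + y\<^sup>2 = int N}"

text \<open>The index set of the sum and the set counted by \<^const>\<open>r2\<close> are finite, so neither
  \<^const>\<open>sum\<close> nor \<^const>\<open>card\<close> takes its default value.\<close>

lemma finite_overpartitions_weight: "finite {p \<in> overpartitions. weight p = N}"
proof (rule finite_subset)
  show "finite {p :: marked_parts. set p \<subseteq> {..N} \<times> UNIV \<and> length p \<le> N}"
    by (rule finite_lists_length_le) simp
  show "{p \<in> overpartitions. weight p = N} \<subseteq> {p. set p \<subseteq> {..N} \<times> UNIV \<and> length p \<le> N}"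
  proof
    fix p assume "p \<in> {p \<in> overpartitions. weight p = N}"
    then have p: "overpartition p" and N: "sum_list (map fst p) = N"
      by (auto simp: overpartitions_def weight_def)
    have len: "length q \<le> sum_list (map fst q)" if "\<forall>x\<in>set q. fst x > 0" for q :: marked_parts
      using that by (induction q) force+
    have "\<forall>x\<in>set p. fst x > 0"
      using p unfolding overpartition_def by (metis in_set_conv_nth)
    with len N have "length p \<le> N" by blast
    moreover have "fst x \<le> N" if "x \<in> set p" for x
      using that N member_le_sum_list[of "fst x" "map fst p"] by auto
    ultimately show "p \<in> {p. set p \<subseteq> {..N} \<times> UNIV \<and> length p \<le> N}"
      by (auto simp: mem_Times_iff)
  qed
qed

lemma finite_r2_set: "finite {(x :: int, y :: int). x\<^sup>2 + y\<^sup>2 = int N}"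
proof (rule finite_subset)
  have "\<bar>x\<bar> \<le> int N" if "x\<^sup>2 + y\<^sup>2 = int N" for x y :: int
  proof -
    have "\<bar>x\<bar> \<le> x\<^sup>2"
    proof (cases "x = 0")
      case False
      then have "1 \<le> \<bar>x\<bar>" by simp
      from self_le_power[OF this, of 2] show ?thesis by simp
    qed simp
    also have "\<dots> \<le> int N" using that by (simp flip: that)
    finally show ?thesis .
  qed
  note * = this
  show "{(x :: int, y :: int). x\<^sup>2 + y\<^sup>2 = int N} \<subseteq> {- int N..int N} \<times> {- int N..int N}"
  proof safe
    fix x y :: int assume xy: "x\<^sup>2 + y\<^sup>2 = int N"
    then have yx: "y\<^sup>2 + x\<^sup>2 = int N" by simp
    show "x \<in> {- int N..int N}" "y \<in> {- int N..int N}"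
      using *[OF xy] *[OF yx] by auto
  qed
qed simp

end

theory Submission
  imports Defs "HOL-Computational_Algebra.Formal_Power_Series"
begin

text \<open>
  Put \<open>x = - q\<close>, and let \<open>A n\<close> and \<open>C n\<close> be the generating functions, signed by the number of
  parts, of the overpartitions with all parts \<open>> n\<close>, respectively with all parts \<open>\<ge> n\<close> and no part
  \<open>n\<close> overlined. Then \<open>A n = (1 + x ^ n) C n\<close> and \<open>A (n - 1) = (1 - x ^ n) C n\<close>, and up to the
  substitution the left-hand side is the coefficient of \<open>\<Sum>\<^sub>s\<^sub>\<ge>\<^sub>1 2 (-1) ^ s C s x ^ s\<close>. Inserting a
  parameter, the truncated sums \<open>A 0 + \<Sum>\<^sub>s\<^sub>\<le>\<^sub>M 2 (-1) ^ s C s x ^ (s k)\<close> satisfy a telescoping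
  recurrence in \<open>k\<close>. For \<open>M\<close> large it is this case of the \<open>q\<close>-binomial theorem and gives
  \<open>(A 0)\<^sup>2\<close> at \<open>k = 1\<close>; for \<open>M = k - 1\<close> it gives Gauss' identity \<open>A 0 = \<Sum>\<^sub>k (-1) ^ k x ^ k\<^sup>2\<close>, the
  sum over all integers \<open>k\<close>. So the sum is \<open>(A 0)\<^sup>2 - A 0\<close>, whose coefficients are those claimed.
\<close>

unbundle fps_syntax

section \<open>Overpartitions built up by appending a smallest part\<close>

lemma overpartition_Nil: "overpartition []"
  by (simp add: overpartition_def)

text \<open>A copy of \<open>m\<close> already in \<open>p\<close> ceases to be the last one, so it
  must not be overlined.\<close>

lemma overpartition_snoc:
  "overpartition (p @ [(m, b)]) \<longleftrightarrow>
     overpartition p \<and> m > 0 \<and> (\<forall>x\<in>set p. m < fst x \<or> x = (m, False))"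
proof -
  have "(\<forall>i<Suc (length p). snd ((p @ [(m, b)]) ! i) \<longrightarrow>
          (\<forall>j. i < j \<and> j < Suc (length p) \<longrightarrow> fst ((p @ [(m, b)]) ! j) \<noteq> fst ((p @ [(m, b)]) ! i)))
    \<longleftrightarrow> (\<forall>i<length p. snd (p ! i) \<longrightarrow> (\<forall>j. i < j \<and> j < length p \<longrightarrow> fst (p ! j) \<noteq> fst (p ! i)))
      \<and> (\<forall>x\<in>set p. snd x \<longrightarrow> fst x \<noteq> m)"
    by (auto simp: all_set_conv_all_nth less_Suc_eq nth_append)
  moreover have "(\<forall>i<Suc (length p). fst ((p @ [(m, b)]) ! i) > 0) \<longleftrightarrow>
      (\<forall>i<length p. fst (p ! i) > 0) \<and> m > 0"
    by (auto simp: less_Suc_eq nth_append)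
  moreover have "sorted_wrt (\<ge>) (map fst (p @ [(m, b)])) \<longleftrightarrow>
      sorted_wrt (\<ge>) (map fst p) \<and> (\<forall>x\<in>set p. m \<le> fst x)"
    by (auto simp: sorted_wrt_append)
  ultimately show ?thesis
    unfolding overpartition_def by (auto simp: le_less prod_eq_iff)
qed

lemma smallest_part_snoc:
  "overpartition (p @ [(m, b)]) \<Longrightarrow> smallest_part (p @ [(m, b)]) = m"
  unfolding smallest_part_def overpartition_snoc by (intro Min_eqI) auto

lemma finite_overpartition_weight: "finite {p. overpartition p \<and> weight p = N}"
  by (rule finite_subset[OF _ finite.insertI[OF finite_overpartitions_weight[of N], of "[]"]])
     (auto simp: overpartitions_def)

text \<open>The sign by length absorbs the substitution \<open>x = - q\<close>: since the weight of \<open>p\<close> has the parity of its number of odd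
  parts, \<open>(-1) ^ (weight p + num_even_parts p) = (-1) ^ length p\<close>.\<close>

definition signed_gf :: "marked_parts set \<Rightarrow> int fps" where
  "signed_gf S = Abs_fps (\<lambda>N. \<Sum>p | p \<in> S \<and> weight p = N. (- 1) ^ length p)"

lemma weight_add_even_parts:
  "(- 1 :: int) ^ (weight p + num_even_parts p) = (- 1) ^ length p"
  by (induction p) (auto simp: weight_def num_even_parts_def power_add)

lemma signed_gf_Un:
  assumes "S \<subseteq> Collect overpartition" "T \<subseteq> Collect overpartition" "S \<inter> T = {}"
  shows "signed_gf (S \<union> T) = signed_gf S + signed_gf T"
proof (rule fps_ext)
  fix N
  have fin: "finite {p \<in> U. weight p = N}" if "U \<subseteq> Collect overpartition" for U
    using that by (intro finite_subset[OF _ finite_overpartition_weight[of N]]) auto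
  have "{p \<in> S \<union> T. weight p = N} = {p \<in> S. weight p = N} \<union> {p \<in> T. weight p = N}"
    by auto
  then show "signed_gf (S \<union> T) $ N = (signed_gf S + signed_gf T) $ N"
    using assms(3) by (simp add: signed_gf_def) (subst sum.union_disjoint; auto intro!: fin assms)
qed

lemma signed_gf_snoc:
  "signed_gf ((\<lambda>p. p @ [(m, b)]) ` S) = - (fps_X ^ m * signed_gf S)"
proof (rule fps_ext)
  fix N
  show "signed_gf ((\<lambda>p. p @ [(m, b)]) ` S) $ N = (- (fps_X ^ m * signed_gf S)) $ N"
  proof (cases "N < m")
    case True
    then have "{p \<in> (\<lambda>p. p @ [(m, b)]) ` S. weight p = N} = {}"
      by (auto simp: weight_def)
    then have "signed_gf ((\<lambda>p. p @ [(m, b)]) ` S) $ N = 0"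
      unfolding signed_gf_def fps_nth_Abs_fps by (simp only: sum.empty)
    with True show ?thesis
      by (simp add: fps_X_power_mult_nth)
  next
    case False
    then have "{p \<in> (\<lambda>p. p @ [(m, b)]) ` S. weight p = N} =
        (\<lambda>p. p @ [(m, b)]) ` {p \<in> S. weight p = N - m}"
      by (auto simp: weight_def)
    with False show ?thesis
      by (simp add: signed_gf_def fps_X_power_mult_nth sum.reindex inj_on_def sum_negf)
  qed
qed

section \<open>Generating functions with a lower bound on the parts\<close>

definition parts_above :: "nat \<Rightarrow> marked_parts set" where
  "parts_above n = {p. overpartition p \<and> (\<forall>x\<in>set p. n < fst x)}"

text \<open>For \<open>n > 0\<close>, exactly the lists to which a part \<open>n\<close> may be
  appended, overlined or not.\<close>

definition unmarked_from :: "nat \<Rightarrow> marked_parts set" where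
  "unmarked_from n = {p. overpartition p \<and> (\<forall>x\<in>set p. n < fst x \<or> x = (n, False))}"

lemma snoc_in_overpartition_iff:
  "overpartition (p @ [(m, b)]) \<longleftrightarrow> m > 0 \<and> p \<in> unmarked_from m"
  by (auto simp: overpartition_snoc unmarked_from_def)

lemma unmarked_from_eq:
  assumes "n > 0"
  shows "unmarked_from n = parts_above n \<union> (\<lambda>p. p @ [(n, False)]) ` unmarked_from n"
proof (rule set_eqI)
  fix p
  show "p \<in> unmarked_from n \<longleftrightarrow>
        p \<in> parts_above n \<union> (\<lambda>p. p @ [(n, False)]) ` unmarked_from n"
  proof (cases p rule: rev_cases)
    case Nil
    then show ?thesis by (auto simp: unmarked_from_def parts_above_def)
  next
    case (snoc q x)
    with assms show ?thesis
      by (cases x) (auto simp: image_iff unmarked_from_def parts_above_def overpartition_snoc)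
  qed
qed

text \<open>Split by whether \<open>Suc n\<close> occurs and, if so, whether its last copy is
  overlined. Removing that copy leaves a list in \<open>unmarked_from (Suc n)\<close> either
  way.\<close>

lemma parts_above_eq:
  "parts_above n = parts_above (Suc n) \<union>
     (\<lambda>p. p @ [(Suc n, False)]) ` unmarked_from (Suc n) \<union>
     (\<lambda>p. p @ [(Suc n, True)]) ` unmarked_from (Suc n)"
proof (rule set_eqI)
  fix p
  show "p \<in> parts_above n \<longleftrightarrow> p \<in> parts_above (Suc n) \<union>
     (\<lambda>p. p @ [(Suc n, False)]) ` unmarked_from (Suc n) \<union>
     (\<lambda>p. p @ [(Suc n, True)]) ` unmarked_from (Suc n)"
  proof (cases p rule: rev_cases)
    case Nil
    then show ?thesis by (auto simp: parts_above_def)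
  next
    case (snoc q x)
    obtain m b where x: "x = (m, b)" by fastforce
    show ?thesis
    proof (cases "m = Suc n")
      case True
      then show ?thesis
        using snoc x by (cases b) (auto simp: image_iff unmarked_from_def parts_above_def overpartition_snoc)
    next
      case False
      then show ?thesis
        using snoc x by (auto simp: image_iff parts_above_def overpartition_snoc)
    qed
  qed
qed

abbreviation above_gf :: "nat \<Rightarrow> int fps" where
  "above_gf n \<equiv> signed_gf (parts_above n)"

abbreviation unmarked_gf :: "nat \<Rightarrow> int fps" where
  "unmarked_gf n \<equiv> signed_gf (unmarked_from n)"

lemma above_gf_eq:
  assumes "n > 0"
  shows "above_gf n = (1 + fps_X ^ n) * unmarked_gf n"
proof -
  have "unmarked_gf n = signed_gf (parts_above n \<union> (\<lambda>p. p @ [(n, False)]) ` unmarked_from n)"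
    using unmarked_from_eq[OF assms] by simp
  also have "\<dots> = above_gf n - fps_X ^ n * unmarked_gf n"
    using assms
    by (subst signed_gf_Un) (auto simp: signed_gf_snoc snoc_in_overpartition_iff, auto simp: parts_above_def)
  finally show ?thesis by (simp add: algebra_simps)
qed

lemma above_gf_Suc_eq: "above_gf n = (1 - fps_X ^ Suc n) * unmarked_gf (Suc n)"
proof -
  have "above_gf n = above_gf (Suc n) - 2 * fps_X ^ Suc n * unmarked_gf (Suc n)"
    by (subst parts_above_eq, subst signed_gf_Un,
        auto simp: snoc_in_overpartition_iff simp del: power_Suc, auto simp: parts_above_def simp del: power_Suc,
        subst signed_gf_Un)
       (auto simp: signed_gf_snoc snoc_in_overpartition_iff parts_above_def simp del: power_Suc)
  then show ?thesis
    by (simp add: above_gf_eq algebra_simps del: power_Suc)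
qed

text \<open>A single part above \<open>n\<close> already makes the weight exceed \<open>n\<close>,
  so only the empty list contributes.\<close>

lemma above_gf_nth:
  assumes "i \<le> n"
  shows "above_gf n $ i = of_bool (i = 0)"
proof -
  have "{p \<in> parts_above n. weight p = i} = (if i = 0 then {[]} else {})"
  proof -
    have "p \<in> parts_above n \<and> weight p = i \<longleftrightarrow> p = [] \<and> i = 0" for p
      using assms by (cases p) (auto simp: parts_above_def overpartition_Nil weight_def)
    then show ?thesis by simp
  qed
  then show ?thesis by (simp add: signed_gf_def)
qed

lemma minus_one_power_mult_nth:
  "((- 1) ^ k * f) $ n = (- 1) ^ k * (f :: 'a :: comm_ring_1 fps) $ n"
  by (cases "even k") auto

lemma fps_X_power_dvd_iff:
  fixes f :: "'a :: comm_ring_1 fps"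
  shows "fps_X ^ n dvd f \<longleftrightarrow> (\<forall>i<n. f $ i = 0)"
proof
  assume "\<forall>i<n. f $ i = 0"
  then have "f = fps_X ^ n * fps_shift n f"
    by (intro fps_ext) (auto simp: fps_X_power_mult_nth)
  then show "fps_X ^ n dvd f" by (rule dvdI)
qed (auto simp: fps_X_power_mult_nth)

lemma above_gf_cong: "fps_X ^ Suc n dvd above_gf n - 1"
  unfolding fps_X_power_dvd_iff by (auto simp: above_gf_nth less_Suc_eq_le)

lemma above_gf_nonzero: "above_gf n \<noteq> 0"
  using above_gf_nth[of 0 n] by auto

text \<open>\<open>above_gf n\<close> has constant term 1 and is therefore a unit.\<close>

lemma dvd_above_gf_mult_cancel:
  assumes "d dvd above_gf n * f"
  shows "d dvd f"
proof -
  obtain g where "above_gf n * g = 1"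
    using fps_right_inverse[of "above_gf n" 1] by (simp add: above_gf_nth)
  then have "f = (above_gf n * f) * g" by (metis mult.assoc mult.commute mult_1)
  with assms show ?thesis by (metis dvd_mult2)
qed

section \<open>The truncated q-binomial sum and its two evaluations\<close>

text \<open>In product form this is \<open>above_gf 0\<close> times (-1)^s (-1;x)_s / (x;x)_s, the
  q-binomial coefficients. At \<open>s = 0\<close> the second formula would count
  \<open>above_gf 0\<close> twice.\<close>

definition qterm :: "nat \<Rightarrow> int fps" where
  "qterm s = (if s = 0 then above_gf 0 else 2 * (- 1) ^ s * unmarked_gf s)"

definition qsum :: "nat \<Rightarrow> nat \<Rightarrow> int fps" where
  "qsum M k = (\<Sum>s\<le>M. qterm s * fps_X ^ (s * k))"

lemma qsum_Suc: "qsum (Suc M) k = qsum M k + qterm (Suc M) * fps_X ^ (Suc M * k)"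
  by (simp add: qsum_def)

text \<open>With \<open>qterm_minus\<close> this encodes the ratio of consecutive terms without
  division: both products equal the same multiple of \<open>above_gf s\<close> up to sign.\<close>

lemma qterm_plus: "(1 + fps_X ^ s) * qterm s = 2 * (- 1) ^ s * above_gf s"
  by (cases "s = 0") (simp_all add: qterm_def above_gf_eq algebra_simps)

lemma qterm_minus: "(1 - fps_X ^ Suc s) * qterm (Suc s) = - (2 * (- 1) ^ s * above_gf s)"
  by (simp add: qterm_def above_gf_Suc_eq algebra_simps del: power_Suc) (simp add: algebra_simps)

text \<open>On moving the sum at \<open>Suc k\<close> to the left, the contributions of
  \<open>qterm s\<close> and \<open>qterm (Suc s)\<close> to the same power x^((s+1)k) cancel; only
  the one from the upper end \<open>s = M\<close> remains.\<close>

lemma qsum_recurrence: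
  "(1 + fps_X ^ k) * qsum M k =
   (1 - fps_X ^ k) * qsum M (Suc k) + fps_X ^ (Suc M * k) * (2 * (- 1) ^ M * above_gf M)"
proof (induction M)
  case 0
  then show ?case by (simp add: qsum_def qterm_def algebra_simps)
next
  case (Suc M)
  define t u where "t = qterm (Suc M)" and "u = 2 * (- 1) ^ M * above_gf M"
  define x y :: "int fps" where "x = fps_X ^ k" and "y = fps_X ^ Suc M"
  define z :: "int fps" where "z = fps_X ^ (Suc M * k)"
  have pw: "fps_X ^ (Suc M * Suc k) = z * y" "fps_X ^ (Suc (Suc M) * k) = z * x"
    by (simp_all add: z_def y_def x_def flip: power_add)
  have u: "u = - ((1 - y) * t)"
    unfolding u_def y_def t_def qterm_minus by simp
  have "(1 + x) * qsum M k = (1 - x) * qsum M (Suc k) + z * u"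
    using Suc unfolding u_def x_def z_def .
  then have "(1 + x) * (qsum M k + t * z) =
      (1 - x) * (qsum M (Suc k) + t * (z * y)) + z * x * ((1 + y) * t)"
    unfolding u by algebra
  then show ?case
    unfolding qsum_Suc pw qterm_plus[symmetric]
    unfolding t_def[symmetric] x_def[symmetric] y_def[symmetric] z_def[symmetric] .
qed

text \<open>Multiplying by \<open>unmarked_gf (Suc k)\<close> turns the factors 1 + x^(k+1) and 1 -
  x^(k+1) into \<open>above_gf (Suc k)\<close> and \<open>above_gf k\<close>, so that steps in
  \<open>k\<close> telescope.\<close>

lemma qsum_above_gf:
  "above_gf (Suc k) * qsum M (Suc k) = above_gf k * qsum M (Suc (Suc k)) +
     fps_X ^ (Suc M * Suc k) * (2 * (- 1) ^ M * above_gf M) * unmarked_gf (Suc k)"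
  using arg_cong[OF qsum_recurrence[of "Suc k" M], of "\<lambda>f. unmarked_gf (Suc k) * f"]
  unfolding above_gf_eq[of "Suc k", simplified] above_gf_Suc_eq[of k]
  by (simp add: algebra_simps)

lemma qsum_cong_qterm: "fps_X ^ k dvd qsum M k - above_gf 0"
proof -
  have "qsum M k = above_gf 0 + (\<Sum>s=1..M. qterm s * fps_X ^ (s * k))"
    unfolding qsum_def atMost_atLeast0 by (subst sum.atLeast_Suc_atMost) (simp_all add: qterm_def)
  moreover have "fps_X ^ k dvd (\<Sum>s=1..M. qterm s * fps_X ^ (s * k) :: int fps)"
    by (intro dvd_sum dvd_mult le_imp_power_dvd) auto
  ultimately show ?thesis by simp
qed

lemma qsum_1_cong: "fps_X ^ Suc M dvd qsum M 1 - above_gf 0 ^ 2"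
proof -
  \<comment> \<open>Descend from \<open>k = M\<close>, where both terms reduce to
    \<open>above_gf 0\<close>. The boundary term of the recurrence vanishes modulo x^(M+1).\<close>
  have "fps_X ^ Suc M dvd qsum M (Suc k) - above_gf 0 * above_gf k" if "k \<le> M" for k
    using that
  proof (induction k rule: inc_induct)
    case base
    have "fps_X ^ Suc M dvd (qsum M (Suc M) - above_gf 0) - above_gf 0 * (above_gf M - 1)"
      by (intro dvd_diff dvd_mult qsum_cong_qterm above_gf_cong)
    then show ?case by (simp add: algebra_simps)
  next
    case (step k)
    have "fps_X ^ Suc M dvd above_gf k * (qsum M (Suc (Suc k)) - above_gf 0 * above_gf (Suc k)) +
        fps_X ^ (Suc M * Suc k) * (2 * (- 1) ^ M * above_gf M) * unmarked_gf (Suc k)"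
      by (intro dvd_add dvd_mult step dvd_mult2 le_imp_power_dvd) auto
    also have "\<dots> = above_gf (Suc k) * (qsum M (Suc k) - above_gf 0 * above_gf k)"
      unfolding right_diff_distrib qsum_above_gf[of k M] by (simp add: mult_ac)
    finally show ?case by (rule dvd_above_gf_mult_cancel)
  qed
  from this[of 0] show ?thesis by (simp add: power2_eq_square)
qed

text \<open>Shanks' finite form of Gauss' identity: modulo \<open>x ^ (n + 1)\<close> the left-hand side is
  \<^term>\<open>above_gf 0\<close>, and \<^term>\<open>above_gf n\<close> is 1.\<close>

lemma qsum_theta:
  "qsum n (Suc n) = above_gf n * (1 + 2 * (\<Sum>k=1..n. (- 1) ^ k * fps_X ^ k\<^sup>2))"
proof (induction n)
  case 0
  then show ?case by (simp add: qsum_def qterm_def)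
next
  case (Suc n)
  let ?T = "\<lambda>n. 1 + 2 * (\<Sum>k=1..n. (- 1) ^ k * fps_X ^ k\<^sup>2) :: int fps"
  define a b c where "a = above_gf n" and "b = above_gf (Suc n)" and "c = unmarked_gf (Suc n)"
  define e x z :: "int fps"
    where "e = (- 1) ^ Suc n" and "x = fps_X ^ Suc n" and "z = fps_X ^ (Suc n)\<^sup>2"
  have pw: "fps_X ^ (Suc n * Suc n) = z" "fps_X ^ (Suc (Suc n) * Suc n) = z * x"
    by (simp_all add: z_def x_def power2_eq_square flip: power_add)
  have q: "qterm (Suc n) = 2 * e * c"
    by (simp add: qterm_def e_def c_def)
  have a: "a = (1 - x) * c"
    unfolding a_def x_def c_def by (rule above_gf_Suc_eq)
  have T: "?T (Suc n) = ?T n + 2 * e * z"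
    by (simp add: e_def z_def algebra_simps)
  \<comment> \<open>The induction hypothesis enters after splitting off the top term. By
    \<open>a = (1 - x) * c\<close>, that term and the boundary term combine to \<open>a * b\<close>
    times the new theta term \<open>2 * e * z\<close>.\<close>
  have "b * (a * ?T n + 2 * e * c * z) = a * qsum (Suc n) (Suc (Suc n)) + z * x * (2 * e * b) * c"
    using qsum_above_gf[of n "Suc n"]
    unfolding qsum_Suc[of n "Suc n"] Suc pw q a_def[symmetric] b_def[symmetric] c_def[symmetric]
      e_def[symmetric] .
  then have "a * qsum (Suc n) (Suc (Suc n)) = a * (b * ?T (Suc n))"
    unfolding T using a by algebra
  then show ?case
    using above_gf_nonzero[of n] by (simp add: a_def b_def)
qed

section \<open>Coefficients: squares and sums of two squares\<close>

lemma minus_one_power_square_root: "m\<^sup>2 = n \<Longrightarrow> (- 1 :: int) ^ m = (- 1) ^ n"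
  by (auto simp: minus_one_power_iff)

lemma above_gf_0_nth_pos:
  assumes "N > 0"
  shows "above_gf 0 $ N = 2 * (- 1) ^ N * of_bool (is_square N)"
proof -
  let ?T = "1 + 2 * (\<Sum>k=1..N. (- 1) ^ k * fps_X ^ k\<^sup>2) :: int fps"
  \<comment> \<open>Two values of \<open>qsum N (Suc N)\<close> modulo x^(N+1) are compared:
    \<open>above_gf 0\<close> and the theta polynomial.\<close>
  have "fps_X ^ Suc N dvd (qsum N (Suc N) - above_gf 0) - (above_gf N - 1) * ?T"
    by (intro dvd_diff dvd_mult2 qsum_cong_qterm above_gf_cong)
  also have "(qsum N (Suc N) - above_gf 0) - (above_gf N - 1) * ?T = ?T - above_gf 0"
    unfolding qsum_theta by (simp add: algebra_simps)
  finally have "above_gf 0 $ N = ?T $ N"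
    unfolding fps_X_power_dvd_iff by simp
  also have "\<dots> = 2 * (\<Sum>k=1..N. (- 1) ^ k * of_bool (k\<^sup>2 = N))"
  proof -
    have "(\<Sum>k=1..N. (- 1) ^ k * fps_X ^ k\<^sup>2 :: int fps) $ N = (\<Sum>k=1..N. (- 1) ^ k * of_bool (k\<^sup>2 = N))"
      unfolding fps_sum_nth minus_one_power_mult_nth
      by (intro sum.cong) (auto simp: fps_X_power_nth)
    then show ?thesis
      using assms by (simp add: numeral_fps_const)
  qed
  also have "(\<Sum>k=1..N. (- 1 :: int) ^ k * of_bool (k\<^sup>2 = N)) = (- 1) ^ N * of_bool (is_square N)"
  proof (cases "is_square N")
    case True
    then obtain m where m: "N = m\<^sup>2" by (auto simp: is_nth_power_def)
    with assms have "m > 0" by auto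
    then have "m \<in> {1..N}" using self_le_power[of m 2] by (simp add: m)
    moreover have "k\<^sup>2 = N \<longleftrightarrow> k = m" for k by (simp add: m power2_eq_iff_nonneg)
    ultimately show ?thesis using True minus_one_power_square_root[of m N] m by simp
  next
    case False
    then have "k\<^sup>2 \<noteq> N" for k by (auto simp: is_nth_power_def)
    with False show ?thesis by simp
  qed
  finally show ?thesis by (simp add: algebra_simps)
qed

lemma finite_square_roots: "finite {x :: int. x\<^sup>2 = int n}"
proof (rule finite_subset)
  show "{x :: int. x\<^sup>2 = int n} \<subseteq> {- int n..int n}"
  proof
    fix x :: int assume "x \<in> {x. x\<^sup>2 = int n}"
    then have "\<bar>x\<bar> \<le> int n"
      using self_le_power[of "\<bar>x\<bar>" 2] by (cases "x = 0") auto
    then show "x \<in> {- int n..int n}" by auto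
  qed
qed simp

lemma card_square_roots:
  assumes "N > 0"
  shows "card {x :: int. x\<^sup>2 = int N} = 2 * of_bool (is_square N)"
proof (cases "is_square N")
  case True
  then obtain m where m: "N = m\<^sup>2" by (auto simp: is_nth_power_def)
  then have "{x :: int. x\<^sup>2 = int N} = {int m, - int m}" by (auto simp: power2_eq_iff)
  with True m assms show ?thesis by simp
next
  case False
  have "is_square N" if "x\<^sup>2 = int N" for x :: int
  proof -
    have "int ((nat \<bar>x\<bar>)\<^sup>2) = int N" using that by simp
    then show ?thesis by (metis is_nth_powerI of_nat_eq_iff)
  qed
  with False have "{x :: int. x\<^sup>2 = int N} = {}" by auto
  with False show ?thesis by simp
qed

text \<open>Counting integer roots covers \<open>N = 0\<close> as well, so squaring the series
  becomes a convolution of counts.\<close>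

lemma above_gf_0_nth: "above_gf 0 $ N = (- 1) ^ N * int (card {x :: int. x\<^sup>2 = int N})"
  by (cases "N = 0") (simp_all add: above_gf_nth above_gf_0_nth_pos card_square_roots)

lemma r2_convolution:
  "r2 N = (\<Sum>i=0..N. card {x :: int. x\<^sup>2 = int i} * card {y :: int. y\<^sup>2 = int (N - i)})"
proof -
  have "{(x :: int, y :: int). x\<^sup>2 + y\<^sup>2 = int N} =
      (\<Union>i\<in>{0..N}. {x. x\<^sup>2 = int i} \<times> {y. y\<^sup>2 = int (N - i)})"
  proof (intro set_eqI iffI)
    fix z :: "int \<times> int"
    assume "z \<in> {(x, y). x\<^sup>2 + y\<^sup>2 = int N}"
    then obtain x y where z: "z = (x, y)" "x\<^sup>2 + y\<^sup>2 = int N" by auto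
    then have "nat (x\<^sup>2) \<le> N" by (simp add: nat_le_iff flip: z(2))
    with z show "z \<in> (\<Union>i\<in>{0..N}. {x. x\<^sup>2 = int i} \<times> {y. y\<^sup>2 = int (N - i)})"
      by (auto intro!: bexI[of _ "nat (x\<^sup>2)"])
  qed auto
  then have "r2 N = card (\<Union>i\<in>{0..N}. {x :: int. x\<^sup>2 = int i} \<times> {y :: int. y\<^sup>2 = int (N - i)})"
    by (simp add: r2_def)
  also have "\<dots> = (\<Sum>i=0..N. card ({x :: int. x\<^sup>2 = int i} \<times> {y :: int. y\<^sup>2 = int (N - i)}))"
    by (intro card_UN_disjoint ballI finite_cartesian_product finite_square_roots) auto
  finally show ?thesis by (simp add: card_cartesian_product)
qed

lemma above_gf_0_square_nth: "(above_gf 0 ^ 2) $ N = (- 1) ^ N * int (r2 N)"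
proof -
  have "(above_gf 0 ^ 2) $ N = (\<Sum>i=0..N. (- 1) ^ N *
      int (card {x :: int. x\<^sup>2 = int i} * card {y :: int. y\<^sup>2 = int (N - i)}))"
    unfolding power2_eq_square fps_mult_nth above_gf_0_nth
    by (intro sum.cong) (auto simp: mult_ac simp flip: power_add)
  then show ?thesis by (simp add: r2_convolution sum_distrib_left)
qed

section \<open>Summation by smallest part\<close>

lemma overpartitions_smallest_part:
  assumes "s > 0"
  shows "{p \<in> overpartitions. smallest_part p = s} =
    (\<lambda>p. p @ [(s, False)]) ` unmarked_from s \<union> (\<lambda>p. p @ [(s, True)]) ` unmarked_from s"
    (is "?L = ?R")
proof (rule set_eqI)
  fix p
  show "p \<in> ?L \<longleftrightarrow> p \<in> ?R"
  proof (cases p rule: rev_cases)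
    case Nil
    then show ?thesis by (auto simp: overpartitions_def)
  next
    case (snoc q x)
    obtain m b where x: "x = (m, b)" by fastforce
    have "p \<in> ?L \<longleftrightarrow> overpartition p \<and> m = s"
      using smallest_part_snoc[of q m b] snoc x by (auto simp: overpartitions_def)
    also have "\<dots> \<longleftrightarrow> p \<in> ?R"
      using snoc x assms by (cases b) (auto simp: snoc_in_overpartition_iff)
    finally show ?thesis .
  qed
qed

text \<open>The last smallest part, overlined or not, gives the factor 2; its minus sign turns
  (-1)^(s+1) into (-1)^s.\<close>

lemma signed_gf_smallest_part:
  assumes "s > 0"
  shows "(- 1) ^ (s + 1) * signed_gf {p \<in> overpartitions. smallest_part p = s} = qterm s * fps_X ^ s"
  unfolding overpartitions_smallest_part[OF assms]
  using assms by (subst signed_gf_Un) (auto simp: signed_gf_snoc snoc_in_overpartition_iff qterm_def)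

theorem theorem4p7:
  fixes N :: nat
  assumes "N > 0"
  shows "(\<Sum>p | p \<in> overpartitions \<and> weight p = N.
            (- 1 :: int) ^ (smallest_part p + num_even_parts p + 1)) =
         int (r2 N) - 2 * of_bool (is_square N)"
proof -
  let ?P = "{p \<in> overpartitions. weight p = N}"
  let ?S = "\<lambda>s. {p \<in> overpartitions. smallest_part p = s}"
  have range: "smallest_part p \<in> {1..N}" if "p \<in> ?P" for p
  proof -
    from that obtain q m b where p: "p = q @ [(m, b)]"
      by (cases p rule: rev_cases) (auto simp: overpartitions_def)
    with that show ?thesis
      using smallest_part_snoc[of q m b]
      by (auto simp: overpartitions_def overpartition_snoc weight_def)
  qed
  have sign: "(- 1 :: int) ^ (smallest_part p + num_even_parts p + 1) =
      (- 1) ^ N * ((- 1) ^ (smallest_part p + 1) * (- 1) ^ length p)" if "p \<in> ?P" for p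
    using that by (simp add: power_add flip: weight_add_even_parts)
  have "(\<Sum>p\<in>?P. (- 1 :: int) ^ (smallest_part p + num_even_parts p + 1)) =
      (- 1) ^ N * (\<Sum>p\<in>?P. (- 1) ^ (smallest_part p + 1) * (- 1) ^ length p)"
    unfolding sum_distrib_left by (intro sum.cong refl sign)
  also have "(\<Sum>p\<in>?P. (- 1 :: int) ^ (smallest_part p + 1) * (- 1) ^ length p) =
      (\<Sum>s=1..N. \<Sum>p | p \<in> ?P \<and> smallest_part p = s. (- 1) ^ (smallest_part p + 1) * (- 1) ^ length p)"
    using range by (intro sum.group[symmetric] finite_overpartitions_weight) auto
  also have "\<dots> = (\<Sum>s=1..N. ((- 1) ^ (s + 1) * signed_gf (?S s)) $ N)"
  proof (intro sum.cong refl)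
    fix s
    have "{p \<in> ?S s. weight p = N} = {p \<in> ?P. smallest_part p = s}"
      by auto
    then show "(\<Sum>p | p \<in> ?P \<and> smallest_part p = s. (- 1) ^ (smallest_part p + 1) * (- 1) ^ length p)
        = ((- 1) ^ (s + 1) * signed_gf (?S s)) $ N"
      unfolding minus_one_power_mult_nth by (simp add: signed_gf_def sum_distrib_left)
  qed
  also have "\<dots> = (\<Sum>s=1..N. (qterm s * fps_X ^ s) $ N)"
    by (intro sum.cong refl arg_cong[of _ _ "\<lambda>f. f $ N"] signed_gf_smallest_part) auto
  \<comment> \<open>The smallest part is never 0, so the term \<open>s = 0\<close> of
    \<open>qsum\<close> is taken away.\<close>
  also have "\<dots> = (qsum N 1 - above_gf 0) $ N"
    unfolding qsum_def atMost_atLeast0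
    by (subst sum.atLeast_Suc_atMost) (simp_all add: qterm_def fps_sum_nth)
  also have "\<dots> = (above_gf 0 ^ 2 - above_gf 0) $ N"
    using qsum_1_cong[of N] unfolding fps_X_power_dvd_iff by simp
  also have "(- 1) ^ N * \<dots> = int (r2 N) - 2 * of_bool (is_square N)"
    using assms
    by (simp add: above_gf_0_square_nth above_gf_0_nth_pos right_diff_distrib mult.assoc[symmetric]
        flip: power_add)
  finally show ?thesis .
qed

end
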